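(* Let $(H,d)$ be a Hadamard space and $x\in H$. Then $(H^*_x,d_* )$ is a metric space.
   Context: A Hadamard space is a complete $\mathrm{CAT}(0)$ space. For $x\in H$, $\Gamma_x(H)$ is the set of all constant speed geodesics $\gamma:[0,1]\to H$ (i.e. $d(\gamma(s),\gamma(t))=|s-t|\,d(\gamma(0),\gamma(1))$ for all $s,t\in[0,1]$) with $\gamma(0)=x$. For a geodesic $\gamma$, $P_\gamma$ denotes the metric projection onto (the image of) $\gamma$. For $\gamma\in\Gamma_x(H)$ define $\phi_\gamma(x;\cdot):H\to\mathbb{R}_+$ by $\phi_\gamma(x;y):=d(x,P_\gamma y)$. Set $H^*_x:=\{\phi_\gamma(x;\cdot):\gamma\in\Gamma_x(H)\}$ (the dual of $H$ at $x$; write $\phi_\gamma$ for $\phi_\gamma(x;\cdot)$) and $$d_*(\phi_\gamma,\phi_\eta):=\|\phi_\gamma-\phi_\eta\|_\infty:=\sup_{y\in H\setminus\{x\}}\frac{|\phi_\gamma(x;y)-\phi_\eta(x;y)|}{d(x,y)}.$$ *)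

theory Defs
  imports "HOL-Analysis.Analysis"
begin

text \<open>
  A metric space is a carrier set \<open>H\<close> with a distance function \<open>d\<close>, as in the locale
  \<^locale>\<open>Metric_space\<close>. Geodesics are total functions on the reals of which only the values
  on \<open>[0,1]\<close> are relevant.
\<close>

definition geodesic :: "'a set \<Rightarrow> ('a \<Rightarrow> 'a \<Rightarrow> real) \<Rightarrow> (real \<Rightarrow> 'a) \<Rightarrow> bool" where
  "geodesic H d \<gamma> \<longleftrightarrow>
     \<gamma> \<in> {0..1} \<rightarrow> H \<and>
     (\<forall>s\<in>{0..1}. \<forall>t\<in>{0..1}. d (\<gamma> s) (\<gamma> t) = \<bar>s - t\<bar> * d (\<gamma> 0) (\<gamma> 1))"

definition geodesic_between ::
  "'a set \<Rightarrow> ('a \<Rightarrow> 'a \<Rightarrow> real) \<Rightarrow> 'a \<Rightarrow> 'a \<Rightarrow> (real \<Rightarrow> 'a) \<Rightarrow> bool" where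
  "geodesic_between H d p q \<gamma> \<longleftrightarrow> geodesic H d \<gamma> \<and> \<gamma> 0 = p \<and> \<gamma> 1 = q"

definition geodesics_from :: "'a set \<Rightarrow> ('a \<Rightarrow> 'a \<Rightarrow> real) \<Rightarrow> 'a \<Rightarrow> (real \<Rightarrow> 'a) set" where
  "geodesics_from H d x = {\<gamma>. geodesic H d \<gamma> \<and> \<gamma> 0 = x}"

text \<open>
  The points of one side \<open>\<gamma>\<close> of a geodesic triangle, each paired with its comparison point on
  the Euclidean segment from \<open>p'\<close> to \<open>q'\<close>.
\<close>

definition comparison_side ::
  "(real \<Rightarrow> 'a) \<Rightarrow> real^2 \<Rightarrow> real^2 \<Rightarrow> ('a \<times> (real^2)) set" where
  "comparison_side \<gamma> p' q' = {(\<gamma> t, (1 - t) *\<^sub>R p' + t *\<^sub>R q') | t. t \<in> {0..1}}"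

text \<open>
  A CAT(0) space is a geodesic metric space in which no geodesic triangle is fatter than its
  comparison triangle in the Euclidean plane.
\<close>

definition CAT0_space :: "'a set \<Rightarrow> ('a \<Rightarrow> 'a \<Rightarrow> real) \<Rightarrow> bool" where
  "CAT0_space H d \<longleftrightarrow>
     Metric_space H d \<and>
     (\<forall>p\<in>H. \<forall>q\<in>H. \<exists>\<gamma>. geodesic_between H d p q \<gamma>) \<and>
     (\<forall>p q r \<alpha> \<beta> \<gamma> p' q' r'.
        geodesic_between H d p q \<alpha> \<and> geodesic_between H d q r \<beta> \<and> geodesic_between H d r p \<gamma> \<and>
        dist p' q' = d p q \<and> dist q' r' = d q r \<and> dist r' p' = d r p \<longrightarrow>
        (let T = comparison_side \<alpha> p' q' \<union> comparison_side \<beta> q' r' \<union> comparison_side \<gamma> r' p'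
         in \<forall>(a, a')\<in>T. \<forall>(b, b')\<in>T. d a b \<le> dist a' b'))"

definition Hadamard_space :: "'a set \<Rightarrow> ('a \<Rightarrow> 'a \<Rightarrow> real) \<Rightarrow> bool" where
  "Hadamard_space H d \<longleftrightarrow> CAT0_space H d \<and> Metric_space.mcomplete H d"

definition metric_proj :: "('a \<Rightarrow> 'a \<Rightarrow> real) \<Rightarrow> 'a set \<Rightarrow> 'a \<Rightarrow> 'a" where
  "metric_proj d C y = (THE z. z \<in> C \<and> (\<forall>w\<in>C. d y z \<le> d y w))"

text \<open>
  Functions on \<open>H\<close> are represented extensionally, so that equality of two elements of the dual
  is equality on \<open>H\<close>.
\<close>

definition dual_fun ::
  "'a set \<Rightarrow> ('a \<Rightarrow> 'a \<Rightarrow> real) \<Rightarrow> 'a \<Rightarrow> (real \<Rightarrow> 'a) \<Rightarrow> 'a \<Rightarrow> real" where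
  "dual_fun H d x \<gamma> = (\<lambda>y\<in>H. d x (metric_proj d (\<gamma> ` {0..1}) y))"

definition dual_space :: "'a set \<Rightarrow> ('a \<Rightarrow> 'a \<Rightarrow> real) \<Rightarrow> 'a \<Rightarrow> ('a \<Rightarrow> real) set" where
  "dual_space H d x = dual_fun H d x ` geodesics_from H d x"

text \<open>
  The supremum is taken in \<open>[0,\<infinity>]\<close>, so finiteness is not built into the definition, and the
  supremum over the empty set (the case \<open>H = {x}\<close>) is \<open>0\<close>.
\<close>

definition dual_dist ::
  "'a set \<Rightarrow> ('a \<Rightarrow> 'a \<Rightarrow> real) \<Rightarrow> 'a \<Rightarrow> ('a \<Rightarrow> real) \<Rightarrow> ('a \<Rightarrow> real) \<Rightarrow> ennreal" where
  "dual_dist H d x \<phi> \<psi> = (SUP y\<in>H - {x}. ennreal (\<bar>\<phi> y - \<psi> y\<bar> / d x y))"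

end

theory Submission
  imports Defs
begin

text \<open>
  The distance is the supremum norm of the difference of two functions, weighted by
  \<open>1 / d x y\<close>, so symmetry and the triangle inequality are inherited from the real line
  (\<open>dual_dist_triangle\<close>). Two points depend on the geometry, and both reduce to the projection
  onto a geodesic starting in \<open>x\<close> being a genuine nearest point.

  Finiteness: \<open>x\<close> lies on the geodesic, so the projection \<open>z\<close> of \<open>y\<close> satisfies
  \<open>d y z \<le> d y x\<close>, whence \<open>d x z \<le> 2 * d x y\<close>. The elements of the dual thus grow at most
  linearly and any two have distance at most \<open>4\<close>. Definiteness: the supremum ignores the value at \<open>x\<close>, but the same
  estimate forces every element of the dual to vanish there.

  The nearest point exists because the image of a geodesic is compact, and it is unique because
  in a CAT(0) space the midpoint of two distinct points equidistant from \<open>y\<close> is strictly closer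
  to \<open>y\<close> (\<open>CAT0_midpoint_closer\<close>).
\<close>

section \<open>Midpoints in CAT(0) spaces\<close>

lemma isosceles_triangle_plane:
  fixes a r :: real
  assumes "0 \<le> a" "a \<le> r"
  obtains p q o' :: "real^2" where
    "dist p q = 2 * a" "dist q o' = r" "dist o' p = r"
    "dist ((1/2) *\<^sub>R p + (1/2) *\<^sub>R q) o' = sqrt (r\<^sup>2 - a\<^sup>2)"
proof
  let ?e = "axis 1 1 :: real^2" and ?f = "axis 2 1 :: real^2"
  define h where "h = sqrt (r\<^sup>2 - a\<^sup>2)"
  have "a\<^sup>2 \<le> r\<^sup>2"
    using assms by (simp add: power_mono)
  then have h: "h * h = r\<^sup>2 - a\<^sup>2" "h \<ge> 0"
    by (simp_all add: h_def)
  have n: "norm (u *\<^sub>R ?e + v *\<^sub>R ?f) = sqrt (u * u + v * v)" for u v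
    by (simp add: norm_eq_sqrt_inner inner_axis_axis inner_add_left inner_add_right)
  let ?p = "(- a) *\<^sub>R ?e" and ?q = "a *\<^sub>R ?e" and ?o = "h *\<^sub>R ?f"
  have pq: "?p - ?q = (- 2 * a) *\<^sub>R ?e + 0 *\<^sub>R ?f"
    by (simp flip: scaleR_left_distrib scaleR_left_diff_distrib scaleR_minus_left)
  show "dist ?p ?q = 2 * a"
    unfolding dist_norm pq n using assms by (simp add: real_sqrt_mult)
  have qo: "?q - ?o = a *\<^sub>R ?e + (- h) *\<^sub>R ?f" and op: "?o - ?p = a *\<^sub>R ?e + h *\<^sub>R ?f"
    by simp_all
  show "dist ?q ?o = r" "dist ?o ?p = r"
    unfolding dist_norm qo op n using assms h by (simp_all add: power2_eq_square)
  have mo: "(1/2) *\<^sub>R ?p + (1/2) *\<^sub>R ?q - ?o = 0 *\<^sub>R ?e + (- h) *\<^sub>R ?f"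
    by simp
  show "dist ((1/2) *\<^sub>R ?p + (1/2) *\<^sub>R ?q) ?o = sqrt (r\<^sup>2 - a\<^sup>2)"
    unfolding dist_norm mo n using h by simp
qed

lemma CAT0_geodesic_exists:
  assumes "CAT0_space H d" "p \<in> H" "q \<in> H"
  obtains \<gamma> where "geodesic_between H d p q \<gamma>"
  using assms unfolding CAT0_space_def by meson

lemma CAT0_comparison:
  assumes "CAT0_space H d"
    and "geodesic_between H d p q \<alpha>" "geodesic_between H d q r \<beta>" "geodesic_between H d r p \<gamma>"
    and "dist p' q' = d p q" "dist q' r' = d q r" "dist r' p' = d r p"
    and "(a, a') \<in> comparison_side \<alpha> p' q'" "(b, b') \<in> comparison_side \<beta> q' r'"
  shows "d a b \<le> dist a' b'"
proof -
  let ?T = "comparison_side \<alpha> p' q' \<union> comparison_side \<beta> q' r' \<union> comparison_side \<gamma> r' p'"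
  have "\<forall>(a, a')\<in>?T. \<forall>(b, b')\<in>?T. d a b \<le> dist a' b'"
    using assms(1)[unfolded CAT0_space_def Let_def, THEN conjunct2, THEN conjunct2, rule_format,
        OF conjI[OF assms(2) conjI[OF assms(3) conjI[OF assms(4)
          conjI[OF assms(5) conjI[OF assms(6) assms(7)]]]]]]
    by blast
  then have "\<forall>v\<in>?T. \<forall>w\<in>?T. d (fst v) (fst w) \<le> dist (snd v) (snd w)"
    by (simp only: split_beta')
  from this[rule_format, of "(a, a')" "(b, b')"] show ?thesis
    using assms(8,9) by simp
qed

text \<open>
  The height of the isosceles comparison triangle is a leg of a right triangle whose hypotenuse is
  one of the equal sides, and the other leg is nonzero.
\<close>

lemma CAT0_midpoint_closer:
  assumes "CAT0_space H d" "y \<in> H"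
    and \<alpha>: "geodesic_between H d p q \<alpha>"
    and eq: "d y p = d y q" and "p \<noteq> q"
  shows "d y (\<alpha> (1/2)) < d y p"
proof -
  interpret Metric_space H d
    using assms by (simp add: CAT0_space_def)
  have H: "p \<in> H" "q \<in> H" "\<alpha> (1/2) \<in> H"
    using \<alpha> by (auto simp: geodesic_between_def geodesic_def Pi_iff)
  obtain \<beta> \<gamma> where \<beta>: "geodesic_between H d q y \<beta>" and \<gamma>: "geodesic_between H d y p \<gamma>"
    using CAT0_geodesic_exists assms(1,2) H by metis
  have "0 < d p q"
    using H \<open>p \<noteq> q\<close> by simp
  have "d p q \<le> 2 * d y p"
    using triangle[of p y q] H assms by (simp add: commute)
  then obtain p' q' o' :: "real^2" where tri:
    "dist p' q' = d p q" "dist q' o' = d y p" "dist o' p' = d y p"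
    "dist ((1/2) *\<^sub>R p' + (1/2) *\<^sub>R q') o' = sqrt ((d y p)\<^sup>2 - (d p q / 2)\<^sup>2)"
    using isosceles_triangle_plane[of "d p q / 2" "d y p"] by auto
  have "dist q' o' = d q y"
    using tri eq by (simp add: commute)
  note thin = CAT0_comparison[OF assms(1) \<alpha> \<beta> \<gamma> tri(1) this tri(3)]
  have "(\<alpha> (1/2), (1/2) *\<^sub>R p' + (1/2) *\<^sub>R q') \<in> comparison_side \<alpha> p' q'"
    by (auto simp: comparison_side_def intro!: exI[of _ "1/2"])
  moreover have "(y, o') \<in> comparison_side \<beta> q' o'"
    using \<beta> by (auto simp: comparison_side_def geodesic_between_def intro!: exI[of _ 1])
  ultimately have "d y (\<alpha> (1/2)) \<le> sqrt ((d y p)\<^sup>2 - (d p q / 2)\<^sup>2)"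
    using thin tri(4) by (metis commute)
  also have "\<dots> < sqrt ((d y p)\<^sup>2)"
    using \<open>0 < d p q\<close> by (subst real_sqrt_less_iff) simp
  finally show ?thesis
    by simp
qed

section \<open>Projection onto a geodesic\<close>

lemma geodesic_dist:
  assumes "geodesic H d \<gamma>" "s \<in> {0..1}" "t \<in> {0..1}"
  shows "d (\<gamma> s) (\<gamma> t) = \<bar>s - t\<bar> * d (\<gamma> 0) (\<gamma> 1)"
  using assms unfolding geodesic_def by blast

lemma geodesic_between_subsegment:
  assumes "geodesic H d \<gamma>" "s \<in> {0..1}" "t \<in> {0..1}"
  shows "geodesic_between H d (\<gamma> s) (\<gamma> t) (\<lambda>u. \<gamma> ((1 - u) * s + u * t))"
proof -
  have in01: "(1 - u) * s + u * t \<in> {0..1}" if "u \<in> {0..1}" for u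
    using convexD_alt[OF convex_real_interval(5), of s 0 1 t u] assms that by simp
  have "\<bar>((1 - u) * s + u * t) - ((1 - v) * s + v * t)\<bar> = \<bar>u - v\<bar> * \<bar>s - t\<bar>" for u v
  proof -
    have "((1 - u) * s + u * t) - ((1 - v) * s + v * t) = (u - v) * (t - s)"
      by (simp add: algebra_simps)
    then show ?thesis
      by (simp add: abs_mult abs_minus_commute)
  qed
  then have "d (\<gamma> ((1 - u) * s + u * t)) (\<gamma> ((1 - v) * s + v * t)) = \<bar>u - v\<bar> * d (\<gamma> s) (\<gamma> t)"
    if "u \<in> {0..1}" "v \<in> {0..1}" for u v
    using geodesic_dist[OF assms(1) in01[OF that(1)] in01[OF that(2)]] geodesic_dist[OF assms]
    by simp
  moreover have "\<gamma> ((1 - u) * s + u * t) \<in> H" if "u \<in> {0..1}" for u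
    using assms(1) in01[OF that] unfolding geodesic_def by blast
  ultimately show ?thesis
    by (simp add: geodesic_between_def geodesic_def Pi_iff)
qed

lemma geodesic_nearest_point_exists:
  assumes "Metric_space H d" "geodesic H d \<gamma>" "y \<in> H"
  shows "\<exists>z\<in>\<gamma> ` {0..1}. \<forall>w\<in>\<gamma> ` {0..1}. d y z \<le> d y w"
proof -
  interpret Metric_space H d by fact
  have \<gamma>: "\<gamma> t \<in> H" if "t \<in> {0..1}" for t
    using assms that by (auto simp: geodesic_def)
  have "(d (\<gamma> 0) (\<gamma> 1))-lipschitz_on {0..1} (\<lambda>t. d y (\<gamma> t))"
  proof (rule lipschitz_onI)
    fix s t :: real assume st: "s \<in> {0..1}" "t \<in> {0..1}"
    have "d y (\<gamma> s) \<le> d y (\<gamma> t) + d (\<gamma> s) (\<gamma> t)" "d y (\<gamma> t) \<le> d y (\<gamma> s) + d (\<gamma> s) (\<gamma> t)"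
      using triangle[of y "\<gamma> t" "\<gamma> s"] triangle[of y "\<gamma> s" "\<gamma> t"] \<gamma> st assms(3)
      by (simp_all add: commute)
    moreover have "d (\<gamma> s) (\<gamma> t) = d (\<gamma> 0) (\<gamma> 1) * dist s t"
      using geodesic_dist[OF assms(2) st] by (simp add: dist_real_def)
    ultimately show "dist (d y (\<gamma> s)) (d y (\<gamma> t)) \<le> d (\<gamma> 0) (\<gamma> 1) * dist s t"
      by (simp add: dist_real_def)
  qed simp
  then have "continuous_on {0..1} (\<lambda>t. d y (\<gamma> t))"
    by (rule lipschitz_on_continuous_on)
  then have "\<exists>s\<in>{0..1}. \<forall>t\<in>{0..1}. d y (\<gamma> s) \<le> d y (\<gamma> t)"
    by (intro continuous_attains_inf) auto
  then show ?thesis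
    by auto
qed

lemma metric_proj_geodesic:
  assumes "CAT0_space H d" "geodesic H d \<gamma>" "y \<in> H"
  shows "metric_proj d (\<gamma> ` {0..1}) y \<in> \<gamma> ` {0..1}"
    and "w \<in> \<gamma> ` {0..1} \<Longrightarrow> d y (metric_proj d (\<gamma> ` {0..1}) y) \<le> d y w"
proof -
  let ?C = "\<gamma> ` {0..1}"
  have "Metric_space H d"
    using assms by (simp add: CAT0_space_def)
  then obtain z where z: "z \<in> ?C" and min: "\<forall>w\<in>?C. d y z \<le> d y w"
    using geodesic_nearest_point_exists[OF _ assms(2,3)] by blast
  have "\<exists>!z. z \<in> ?C \<and> (\<forall>w\<in>?C. d y z \<le> d y w)"
  proof (rule ex1I)
    show "z \<in> ?C \<and> (\<forall>w\<in>?C. d y z \<le> d y w)"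
      using z min by (rule conjI)
  next
    fix z' assume z': "z' \<in> ?C \<and> (\<forall>w\<in>?C. d y z' \<le> d y w)"
    obtain s t where st: "s \<in> {0..1}" "t \<in> {0..1}" and eqs: "z = \<gamma> s" "z' = \<gamma> t"
      using z conjunct1[OF z'] by (elim imageE)
    define \<sigma> where "\<sigma> = (\<lambda>u. \<gamma> ((1 - u) * s + u * t))"
    have "geodesic_between H d z z' \<sigma>"
      unfolding \<sigma>_def eqs by (rule geodesic_between_subsegment[OF assms(2) st])
    moreover have "d y z = d y z'"
      using bspec[OF min conjunct1[OF z']] bspec[OF conjunct2[OF z'] z] by (rule order.antisym)
    moreover have "\<sigma> (1/2) \<in> ?C"
      unfolding \<sigma>_def using st by (intro imageI) auto
    with min have "d y z \<le> d y (\<sigma> (1/2))"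
      by (rule bspec)
    ultimately show "z' = z"
      using CAT0_midpoint_closer[OF assms(1,3)] by (metis not_less)
  qed
  note nearest = theI'[OF this, folded metric_proj_def]
  show "metric_proj d ?C y \<in> ?C"
    using nearest by (rule conjunct1)
  show "d y (metric_proj d ?C y) \<le> d y w" if "w \<in> ?C"
    using conjunct2[OF nearest] that by (rule bspec)
qed

text \<open>
  The estimate contains both geometric facts about the dual: linear growth, and, for
  \<open>y = x\<close>, vanishing at the base point.
\<close>

lemma dual_space_bound:
  assumes "CAT0_space H d" "x \<in> H" "\<phi> \<in> dual_space H d x" "y \<in> H"
  shows "\<bar>\<phi> y\<bar> \<le> 2 * d x y"
proof -
  interpret Metric_space H d
    using assms by (simp add: CAT0_space_def)
  obtain \<gamma> where \<gamma>: "geodesic H d \<gamma>" "\<gamma> 0 = x" and \<phi>: "\<phi> = dual_fun H d x \<gamma>"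
    using assms by (auto simp: dual_space_def geodesics_from_def)
  define z where "z = metric_proj d (\<gamma> ` {0..1}) y"
  have "x \<in> \<gamma> ` {0..1}"
    using \<gamma> by force
  then have "z \<in> \<gamma> ` {0..1}" "d y z \<le> d y x"
    unfolding z_def using metric_proj_geodesic[OF assms(1) \<gamma>(1) assms(4)] by blast+
  moreover from this have "z \<in> H"
    using \<gamma> by (auto simp: geodesic_def)
  ultimately have "d x z \<le> 2 * d x y"
    using triangle[of x y z] assms by (simp add: commute)
  then show ?thesis
    using assms by (simp add: \<phi> dual_fun_def z_def)
qed

section \<open>The weighted supremum distance\<close>

lemma dual_dist_commute: "dual_dist H d x \<phi> \<psi> = dual_dist H d x \<psi> \<phi>"
  by (simp add: dual_dist_def abs_minus_commute)

lemma dual_dist_triangle: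
  assumes "Metric_space H d"
  shows "dual_dist H d x \<phi> \<theta> \<le> dual_dist H d x \<phi> \<psi> + dual_dist H d x \<psi> \<theta>"
proof -
  interpret Metric_space H d by fact
  show ?thesis
    unfolding dual_dist_def[of H d x \<phi> \<theta>]
  proof (rule SUP_least)
    fix y assume y: "y \<in> H - {x}"
    have "\<bar>\<phi> y - \<theta> y\<bar> / d x y \<le> \<bar>\<phi> y - \<psi> y\<bar> / d x y + \<bar>\<psi> y - \<theta> y\<bar> / d x y"
      unfolding add_divide_distrib[symmetric] by (intro divide_right_mono) auto
    then have "ennreal (\<bar>\<phi> y - \<theta> y\<bar> / d x y)
        \<le> ennreal (\<bar>\<phi> y - \<psi> y\<bar> / d x y) + ennreal (\<bar>\<psi> y - \<theta> y\<bar> / d x y)"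
      by (simp add: ennreal_leI flip: ennreal_plus)
    also have "\<dots> \<le> dual_dist H d x \<phi> \<psi> + dual_dist H d x \<psi> \<theta>"
      unfolding dual_dist_def using y by (intro add_mono SUP_upper)
    finally show "ennreal (\<bar>\<phi> y - \<theta> y\<bar> / d x y)
        \<le> dual_dist H d x \<phi> \<psi> + dual_dist H d x \<psi> \<theta>" .
  qed
qed

lemma dual_dist_eq_0_iff:
  assumes "Metric_space H d" "x \<in> H"
  shows "dual_dist H d x \<phi> \<psi> = 0 \<longleftrightarrow> (\<forall>y\<in>H - {x}. \<phi> y = \<psi> y)"
proof -
  interpret Metric_space H d by fact
  have "ennreal (\<bar>\<phi> y - \<psi> y\<bar> / d x y) = 0 \<longleftrightarrow> \<phi> y = \<psi> y" if "y \<in> H - {x}" for y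
  proof -
    have "0 < d x y"
      using that assms by auto
    then show ?thesis
      by (auto simp: ennreal_eq_0_iff divide_le_0_iff)
  qed
  then show ?thesis
    unfolding dual_dist_def bot_ennreal[symmetric] SUP_bot_conv by (simp add: bot_ennreal)
qed

lemma dual_dist_finite:
  assumes "CAT0_space H d" "x \<in> H" "\<phi> \<in> dual_space H d x" "\<psi> \<in> dual_space H d x"
  shows "dual_dist H d x \<phi> \<psi> < \<infinity>"
proof -
  interpret Metric_space H d
    using assms by (simp add: CAT0_space_def)
  have "dual_dist H d x \<phi> \<psi> \<le> ennreal 4"
    unfolding dual_dist_def
  proof (intro SUP_least ennreal_leI)
    fix y assume y: "y \<in> H - {x}"
    then have "0 < d x y"
      using assms by auto
    moreover have "\<bar>\<phi> y\<bar> \<le> 2 * d x y" "\<bar>\<psi> y\<bar> \<le> 2 * d x y"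
      using dual_space_bound[OF assms(1,2)] assms(3,4) y by simp_all
    ultimately show "\<bar>\<phi> y - \<psi> y\<bar> / d x y \<le> 4"
      by (simp add: divide_le_eq)
  qed
  then show ?thesis
    by (simp add: le_less_trans)
qed

text \<open>
  Agreement away from \<open>x\<close> suffices, since elements of the dual vanish at \<open>x\<close> and are
  extensional outside \<open>H\<close>.
\<close>

lemma dual_space_eqI:
  assumes "CAT0_space H d" "x \<in> H" "\<phi> \<in> dual_space H d x" "\<psi> \<in> dual_space H d x"
    and eq: "\<forall>y\<in>H - {x}. \<phi> y = \<psi> y"
  shows "\<phi> = \<psi>"
proof (rule extensionalityI)
  show "\<phi> \<in> extensional H" "\<psi> \<in> extensional H"
    using assms(3,4) by (auto simp: dual_space_def dual_fun_def)
next
  interpret Metric_space H d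
    using assms by (simp add: CAT0_space_def)
  have "\<phi> x = 0" "\<psi> x = 0"
    using dual_space_bound[OF assms(1,2,3,2)] dual_space_bound[OF assms(1,2,4,2)] assms(2)
    by simp_all
  then show "\<phi> y = \<psi> y" if "y \<in> H" for y
    using eq that by (cases "y = x") auto
qed

theorem lemma6:
  fixes H :: "'a set" and d :: "'a \<Rightarrow> 'a \<Rightarrow> real" and x :: 'a
  assumes "Hadamard_space H d"
    and "x \<in> H"
  shows "(\<forall>\<phi>\<in>dual_space H d x. \<forall>\<psi>\<in>dual_space H d x. dual_dist H d x \<phi> \<psi> < \<infinity>) \<and>
    Metric_space (dual_space H d x) (\<lambda>\<phi> \<psi>. enn2real (dual_dist H d x \<phi> \<psi>))"
proof
  let ?D = "dual_dist H d x" and ?S = "dual_space H d x"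
  have cat: "CAT0_space H d"
    using assms by (simp add: Hadamard_space_def)
  then have met: "Metric_space H d"
    by (simp add: CAT0_space_def)
  have fin: "?D \<phi> \<psi> < \<infinity>" if "\<phi> \<in> ?S" "\<psi> \<in> ?S" for \<phi> \<psi>
    using dual_dist_finite[OF cat assms(2) that] .
  then show "\<forall>\<phi>\<in>?S. \<forall>\<psi>\<in>?S. ?D \<phi> \<psi> < \<infinity>"
    by blast
  show "Metric_space ?S (\<lambda>\<phi> \<psi>. enn2real (?D \<phi> \<psi>))"
  proof
    show "0 \<le> enn2real (?D \<phi> \<psi>)" for \<phi> \<psi>
      by simp
    show "enn2real (?D \<phi> \<psi>) = enn2real (?D \<psi> \<phi>)" for \<phi> \<psi>
      by (simp add: dual_dist_commute)
    show "enn2real (?D \<phi> \<psi>) = 0 \<longleftrightarrow> \<phi> = \<psi>" if "\<phi> \<in> ?S" "\<psi> \<in> ?S" for \<phi> \<psi>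
    proof -
      have "enn2real (?D \<phi> \<psi>) = 0 \<longleftrightarrow> ?D \<phi> \<psi> = 0"
        using fin[OF that] by (auto simp: enn2real_eq_0_iff)
      then show ?thesis
        using dual_dist_eq_0_iff[OF met assms(2)] dual_space_eqI[OF cat assms(2) that] by blast
    qed
    show "enn2real (?D \<phi> \<theta>) \<le> enn2real (?D \<phi> \<psi>) + enn2real (?D \<psi> \<theta>)"
      if "\<phi> \<in> ?S" "\<psi> \<in> ?S" "\<theta> \<in> ?S" for \<phi> \<psi> \<theta>
    proof -
      have "enn2real (?D \<phi> \<theta>) \<le> enn2real (?D \<phi> \<psi> + ?D \<psi> \<theta>)"
        using dual_dist_triangle[OF met] fin that by (intro enn2real_mono) auto
      then show ?thesis
        using fin that by (simp add: enn2real_plus)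
    qed
  qed
qed

end
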